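(* Let $\alpha>0$ and let $(\Delta_n)_{n\ge0}$ be a sequence of non-negative real numbers with $\Delta_n\sim\alpha n^{1/2}$ as $n\to\infty$. For each $n$ let $(S^{(1)}_{\Delta_n}(n),S^{(2)}_{\Delta_n}(n))$ be the position at time $n$ of the Markov chain on $\mathbb{Z}^2$ started at $(0,0)$ with transition kernel $K_{\Delta_n}$. Then $$\lim_{n\to+\infty}n^{-1}E\left[S^{(1)}_{\Delta_n}(n)\,S^{(2)}_{\Delta_n}(n)\right]=\int_0^1\exp\left(\frac{4}{\alpha^2}s\right)\,\mathrm{erfc}\left(\frac{2}{\alpha}\sqrt{s}\right)ds.$$
   Context: For a real parameter $\Delta\ge 0$ set $u=\frac{2+2\Delta}{2+\Delta}$. The chain $(S_\Delta(n))_{n\ge0}=(S^{(1)}_\Delta(n),S^{(2)}_\Delta(n))_{n\ge 0}$ is the Markov chain on $\mathbb{Z}^2$ with $S_\Delta(0)=(0,0)$ and transition kernel $K_\Delta$ given by: - if $x\ne y$: from $(x,y)$ the chain jumps to each of the four points $(x\pm1,y\pm1)$ (independent choices of signs) with probability $1/4$; - from $(x,x)$: it jumps to $(x+1,x+1)$ and to $(x-1,x-1)$ with probability $u/4$ each, and to $(x+1,x-1)$ and to $(x-1,x+1)$ with probability $(2-u)/4$ each. The function $\mathrm{erfc}$ is $\mathrm{erfc}(x)=1-\frac{2}{\sqrt\pi}\int_0^x e^{-y^2}dy$. *)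

theory Defs
  imports "HOL-Probability.Probability" "HOL-Library.Landau_Symbols"
begin

(* For x < 0 the interval integral carries the usual sign of an oriented integral. *)
definition erfc :: "real \<Rightarrow> real" where
  "erfc x = 1 - 2 / sqrt pi * (LBINT y=0..ereal x. exp (- (y ^ 2)))"

definition u_par :: "real \<Rightarrow> real" where
  "u_par \<Delta> = (2 + 2 * \<Delta>) / (2 + \<Delta>)"

(* Only meaningful for \<Delta> \<ge> 0, where the weights are nonnegative and sum to 1 (lemma
   step_weights_wf); otherwise pmf_of_list is applied to an ill-formed list. *)
definition step_weights :: "real \<Rightarrow> int \<times> int \<Rightarrow> ((int \<times> int) \<times> real) list" where
  "step_weights \<Delta> = (\<lambda>(x, y).
     if x \<noteq> y then
       [((x + 1, y + 1), 1 / 4), ((x + 1, y - 1), 1 / 4),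
        ((x - 1, y + 1), 1 / 4), ((x - 1, y - 1), 1 / 4)]
     else
       [((x + 1, x + 1), u_par \<Delta> / 4), ((x - 1, x - 1), u_par \<Delta> / 4),
        ((x + 1, x - 1), (2 - u_par \<Delta>) / 4), ((x - 1, x + 1), (2 - u_par \<Delta>) / 4)])"

definition step_kernel :: "real \<Rightarrow> int \<times> int \<Rightarrow> (int \<times> int) pmf" where
  "step_kernel \<Delta> z = pmf_of_list (step_weights \<Delta> z)"

lemma step_weights_wf:
  assumes "\<Delta> \<ge> 0"
  shows "pmf_of_list_wf (step_weights \<Delta> z)"
proof -
  have "0 \<le> u_par \<Delta>" "u_par \<Delta> \<le> 2"
    using assms by (auto simp: u_par_def field_simps)
  then show ?thesis
    by (cases z) (auto simp: step_weights_def pmf_of_list_wf_def field_simps)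
qed

lemma pmf_step_kernel_off_diagonal:
  assumes "\<Delta> \<ge> 0" "x \<noteq> y"
  shows "pmf (step_kernel \<Delta> (x, y)) (x', y') =
    (if x' \<in> {x + 1, x - 1} \<and> y' \<in> {y + 1, y - 1} then 1 / 4 else 0)"
  unfolding step_kernel_def pmf_pmf_of_list[OF step_weights_wf[OF assms(1)]]
  using assms(2) by (auto simp: step_weights_def)

lemma pmf_step_kernel_diagonal:
  assumes "\<Delta> \<ge> 0"
  shows "pmf (step_kernel \<Delta> (x, x)) z =
    (if z \<in> {(x + 1, x + 1), (x - 1, x - 1)} then u_par \<Delta> / 4
     else if z \<in> {(x + 1, x - 1), (x - 1, x + 1)} then (2 - u_par \<Delta>) / 4
     else 0)"
  unfolding step_kernel_def pmf_pmf_of_list[OF step_weights_wf[OF assms]]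
  by (auto simp: step_weights_def)

(* The last axiom is the Markov property
     P(S (n+1) = p (n+1) | S 0 = p 0, ..., S n = p n) = K (p n) {p (n+1)},
   multiplied out so that conditioning events of probability 0 need no special treatment. *)
locale markov_chain = prob_space M
  for M :: "'a measure" +
  fixes K :: "'s :: countable \<Rightarrow> 's pmf" and x0 :: 's and S :: "nat \<Rightarrow> 'a \<Rightarrow> 's"
  assumes random_variable_state: "\<And>n. S n \<in> measurable M (count_space UNIV)"
    and initial_state: "AE \<omega> in M. S 0 \<omega> = x0"
    and markov_property: "\<And>n p.
      prob {\<omega> \<in> space M. \<forall>i\<le>Suc n. S i \<omega> = p i} =
      prob {\<omega> \<in> space M. \<forall>i\<le>n. S i \<omega> = p i} * pmf (K (p n)) (p (Suc n))"

end

theory Submission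
  imports Defs "HOL-Real_Asymp.Real_Asymp"
begin

text \<open>
  Off the diagonal the two increments are uncorrelated, on the diagonal their product has mean
  \<open>u - 1\<close>. Hence the expectation of the product of the coordinates at time \<open>n\<close> is
  \<open>(u - 1) * (p\<^sub>0 + \<dots> + p\<^sub>n\<^sub>-\<^sub>1)\<close>, where \<open>p\<^sub>k\<close> is the probability of being on the diagonal at
  time \<open>k\<close>, and the question is how often a one-dimensional walk visits \<open>0\<close>: half the difference
  of the coordinates is the lazy simple random walk on the integers (stay with probability \<open>1/2\<close>,
  move by \<open>\<plusminus>1\<close> with probability \<open>1/4\<close> each), perturbed at the single point \<open>0\<close>, where it stays with
  probability \<open>u/2\<close> instead.

  Put \<open>\<epsilon> = 2 - u = 2 / (2 + \<Delta>)\<close>. A perturbation at one point only can be undone by superposition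
  (\<open>half_gap_prob_superposition\<close>), which expresses \<open>p\<close> by a renewal equation through the return
  probabilities \<open>q\<^sub>k = (2k choose k) / 4^k\<close> of the unperturbed walk. Their generating function
  \<open>Q(z)\<close> equals \<open>(1 - z)\<close> to the power \<open>-1/2\<close>, so the equation reads
  \<open>P (\<epsilon> Q + 1 - \<epsilon>) = Q\<^sup>2\<close>. The point of the whole proof is that \<open>Q\<^sup>2 = 1 / (1 - z)\<close> is rational:
  multiplication by the conjugate \<open>1 - \<epsilon> - \<epsilon> Q\<close> removes the square root from the left-hand side and
  leaves the first-order recursion
  \<open>(1 - 2\<epsilon>) p\<^sub>n\<^sub>+\<^sub>1 = (1 - \<epsilon>)\<^sup>2 p\<^sub>n - \<epsilon> q\<^sub>n\<^sub>+\<^sub>1\<close> (\<open>perturbed_renewal_recursion\<close>).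

  Two consequences follow. Summing the recursion, \<open>\<epsilon>\<^sup>2 (p\<^sub>0 + \<dots> + p\<^sub>n\<^sub>-\<^sub>1)\<close> is an explicit
  expression in \<open>p\<^sub>n\<close> and \<open>q\<^sub>n\<close>, so that no convergence other than that of the single value \<open>p\<^sub>n\<close>
  is needed. Solving it,
  \<open>p\<^sub>n = r^n (1 - \<epsilon> / (1 - 2\<epsilon>) * (q\<^sub>1 / r + \<dots> + q\<^sub>n / r^n))\<close> with
  \<open>r = (1 - \<epsilon>)\<^sup>2 / (1 - 2\<epsilon>) = 1 + \<epsilon>\<^sup>2 / (1 - 2\<epsilon>)\<close>. In the regime of the theorem
  \<open>\<epsilon>\<^sub>n \<sim> c / sqrt n\<close> with \<open>c = 2 / \<alpha>\<close>, hence \<open>r^n\<close> tends to \<open>exp (c\<^sup>2)\<close>. With \<open>a\<^sup>2 = ln r\<close> the sum of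
  the \<open>a q\<^sub>k exp (- a\<^sup>2 k)\<close> is squeezed between two telescoping sums of increments of
  \<open>erfc (a sqrt x)\<close>, because of the bounds
  \<open>1 / sqrt (\<pi> (k + 1/2)) \<le> q\<^sub>k \<le> 1 / sqrt (\<pi> k)\<close> (\<open>return_prob_lower\<close>, \<open>return_prob_upper\<close>).
  Therefore \<open>p\<^sub>n\<close> tends to \<open>exp (c\<^sup>2) erfc c\<close> (\<open>recursion_limit\<close>), the average of the \<open>p\<^sub>k\<close> tends to
  \<open>(exp (c\<^sup>2) erfc c - 1 + 2 c / sqrt \<pi>) / c\<^sup>2\<close> (\<open>recursion_average_limit\<close>), and the
  fundamental theorem of calculus gives the integral the same value (\<open>integral_exp_erfc\<close>).
\<close>

section \<open>One-time laws of a Markov chain\<close>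

primrec chain_law :: "('s \<Rightarrow> 's pmf) \<Rightarrow> 's \<Rightarrow> nat \<Rightarrow> 's pmf" where
  "chain_law K x 0 = return_pmf x"
| "chain_law K x (Suc n) = bind_pmf (chain_law K x n) K"

text \<open>
  The Markov property speaks of probabilities of whole paths, so the one-time laws are reached
  through the law of the path up to time \<open>n\<close>. Paths are listed with the latest state first, so that
  a step of the chain is a \<open>Cons\<close> and the current state is the head.
\<close>
primrec history_law :: "('s \<Rightarrow> 's pmf) \<Rightarrow> 's \<Rightarrow> nat \<Rightarrow> 's list pmf" where
  "history_law K x 0 = return_pmf [x]"
| "history_law K x (Suc n) =
     bind_pmf (history_law K x n) (\<lambda>h. map_pmf (\<lambda>s. s # h) (K (hd h)))"

lemma map_hd_history_law: "map_pmf hd (history_law K x n) = chain_law K x n"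
proof (induction n)
  case (Suc n)
  show ?case
    by (simp add: Suc.IH[symmetric] map_bind_pmf bind_map_pmf map_pmf_comp map_pmf_idI o_def)
qed simp

lemma pmf_history_law_Nil: "pmf (history_law K x n) [] = 0"
  by (cases n) (auto simp: pmf_eq_0_set_pmf)

lemma pmf_history_law_Cons:
  "pmf (history_law K x (Suc n)) (s # h) = pmf (history_law K x n) h * pmf (K (hd h)) s"
proof -
  have "pmf (map_pmf (\<lambda>s. s # h') (K (hd h'))) (s # h) = pmf (K (hd h)) s * indicator {h} h'" for h'
  proof (cases "h' = h")
    case True
    then show ?thesis
      using pmf_map_inj'[of "\<lambda>s. s # h" "K (hd h)" s] by (simp add: inj_def)
  next
    case False
    then show ?thesis by (auto simp: pmf_eq_0_set_pmf)
  qed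
  then show ?thesis
    by (simp add: pmf_bind measure_pmf_single)
qed

context markov_chain
begin

primrec history :: "nat \<Rightarrow> 'a \<Rightarrow> 's list" where
  "history 0 \<omega> = [S 0 \<omega>]"
| "history (Suc n) \<omega> = S (Suc n) \<omega> # history n \<omega>"

lemma history_eq_iff:
  "history n \<omega> = l \<longleftrightarrow> length l = Suc n \<and> (\<forall>i\<le>n. S i \<omega> = l ! (n - i))"
proof (induction n arbitrary: l)
  case 0
  then show ?case by (cases l) auto
next
  case (Suc n)
  show ?case
  proof (cases l)
    case (Cons s h)
    have "(\<forall>i\<le>Suc n. S i \<omega> = (s # h) ! (Suc n - i)) \<longleftrightarrow>
      S (Suc n) \<omega> = s \<and> (\<forall>i\<le>n. S i \<omega> = h ! (n - i))"
      by (auto simp: le_Suc_eq Suc_diff_le)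
    then show ?thesis by (auto simp: Cons Suc)
  qed simp
qed

lemma measurable_history [measurable]: "history n \<in> measurable M (count_space UNIV)"
proof -
  note random_variable_state[measurable]
  have "{\<omega> \<in> space M. history n \<omega> = l} \<in> sets M" for l
    unfolding history_eq_iff by measurable
  then show ?thesis
    by (auto simp: measurable_count_space_eq2_countable vimage_def Int_def conj_commute)
qed

lemma prob_history: "prob {\<omega> \<in> space M. history n \<omega> = l} = pmf (history_law K x0 n) l"
proof (induction n arbitrary: l)
  case 0
  note random_variable_state[measurable]
  have "prob {\<omega> \<in> space M. history 0 \<omega> = l} = prob {\<omega> \<in> space M. [x0] = l}"
    using initial_state by (intro measure_eq_AE) auto
  also have "\<dots> = pmf (history_law K x0 0) l"
    by (cases "[x0] = l") (auto simp: prob_space pmf_eq_0_set_pmf)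
  finally show ?case .
next
  case (Suc n)
  show ?case
  proof (cases l)
    case Nil
    then show ?thesis by (simp add: pmf_history_law_Nil del: history_law.simps)
  next
    case (Cons s h)
    show ?thesis
    proof (cases "length h = Suc n")
      case True
      define p where "p i = (s # h) ! (Suc n - i)" for i
      have "history n \<omega> = h \<longleftrightarrow> (\<forall>i\<le>n. S i \<omega> = p i)" for \<omega>
        by (auto simp: history_eq_iff p_def True Suc_diff_le)
      moreover have "history (Suc n) \<omega> = s # h \<longleftrightarrow> (\<forall>i\<le>Suc n. S i \<omega> = p i)" for \<omega>
        by (simp only: history_eq_iff p_def) (simp add: True)
      moreover have "p n = hd h" "p (Suc n) = s"
        using True by (auto simp: p_def intro: hd_conv_nth[symmetric])
      ultimately show ?thesis
        using markov_property[of n p]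
        by (simp add: Cons Suc[symmetric] pmf_history_law_Cons del: history_law.simps history.simps)
    next
      case False
      (* a list of the wrong length is no history, and by the induction hypothesis h has no mass *)
      then have *: "{\<omega> \<in> space M. history n \<omega> = h} = {}"
        "{\<omega> \<in> space M. history (Suc n) \<omega> = s # h} = {}"
        by (simp_all add: history_eq_iff del: history.simps)
      show ?thesis
        using Suc[of h]
        by (simp only: Cons pmf_history_law_Cons * measure_empty mult_zero_left)
    qed
  qed
qed

lemma distr_history: "distr M (count_space UNIV) (history n) = measure_pmf (history_law K x0 n)"
proof (rule measure_eqI_countable[where A = UNIV])
  fix l :: "'s list"
  have "emeasure (distr M (count_space UNIV) (history n)) {l} =
      emeasure M {\<omega> \<in> space M. history n \<omega> = l}"
    by (subst emeasure_distr) (auto intro!: arg_cong[where f = "emeasure M"])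
  also have "\<dots> = emeasure (measure_pmf (history_law K x0 n)) {l}"
    by (simp add: emeasure_eq_measure prob_history emeasure_pmf_single)
  finally show "emeasure (distr M (count_space UNIV) (history n)) {l} =
      emeasure (measure_pmf (history_law K x0 n)) {l}" .
qed auto

text \<open>
  Everything to be said about the state at a fixed time depends only on the kernel and the starting
  point; the underlying probability space disappears here.
\<close>
lemma expectation_state:
  fixes f :: "'s \<Rightarrow> real"
  shows "expectation (\<lambda>\<omega>. f (S n \<omega>)) = measure_pmf.expectation (chain_law K x0 n) f"
proof -
  have "S n \<omega> = hd (history n \<omega>)" for \<omega>
    by (cases n) auto
  then have "expectation (\<lambda>\<omega>. f (S n \<omega>)) =
      (\<integral>h. f (hd h) \<partial>distr M (count_space UNIV) (history n))"
    by (subst integral_distr) auto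
  also have "\<dots> = measure_pmf.expectation (map_pmf hd (history_law K x0 n)) f"
    by (simp add: distr_history)
  finally show ?thesis by (simp add: map_hd_history_law)
qed

end

lemma finite_set_pmf_chain_law:
  assumes "\<And>x. finite (set_pmf (K x))"
  shows "finite (set_pmf (chain_law K x n))"
  by (induction n) (auto simp: assms)

lemma expectation_chain_law_Suc:
  fixes K :: "'s \<Rightarrow> 's pmf" and f :: "'s \<Rightarrow> real"
  assumes "\<And>x. finite (set_pmf (K x))"
  shows "measure_pmf.expectation (chain_law K x (Suc n)) f =
    measure_pmf.expectation (chain_law K x n) (\<lambda>z. measure_pmf.expectation (K z) f)"
proof -
  have "finite (set_pmf (chain_law K x n))"
    by (rule finite_set_pmf_chain_law) (rule assms)
  then show ?thesis
    by (simp add: pmf_expectation_bind[OF _ _ order.refl] assms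
        integral_measure_pmf[where A = "set_pmf (chain_law K x n)"])
qed

section \<open>Reduction to the visits of the diagonal\<close>

lemma expectation_step_kernel:
  fixes f :: "int \<times> int \<Rightarrow> real"
  assumes "\<Delta> \<ge> 0"
  shows "measure_pmf.expectation (step_kernel \<Delta> (x, y)) f =
    (if x \<noteq> y then (f (x + 1, y + 1) + f (x + 1, y - 1) + f (x - 1, y + 1) + f (x - 1, y - 1)) / 4
     else u_par \<Delta> / 4 * (f (x + 1, x + 1) + f (x - 1, x - 1))
        + (2 - u_par \<Delta>) / 4 * (f (x + 1, x - 1) + f (x - 1, x + 1)))"
proof -
  let ?A = "{(x + 1, y + 1), (x + 1, y - 1), (x - 1, y + 1), (x - 1, y - 1)}"
  have *: "a \<in> ?A" if "a \<in> set_pmf (step_kernel \<Delta> (x, y))" for a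
    using that assms
    by (cases "x = y"; cases a)
       (auto simp: set_pmf_iff pmf_step_kernel_diagonal pmf_step_kernel_off_diagonal split: if_splits)
  have "measure_pmf.expectation (step_kernel \<Delta> (x, y)) f =
      (\<Sum>a\<in>?A. pmf (step_kernel \<Delta> (x, y)) a * f a)"
    using integral_measure_pmf[of ?A "step_kernel \<Delta> (x, y)" f] * by simp
  then show ?thesis
    using assms
    by (cases "x = y")
       (simp_all add: pmf_step_kernel_diagonal pmf_step_kernel_off_diagonal field_simps)
qed

lemma finite_set_pmf_step_kernel:
  assumes "\<Delta> \<ge> 0"
  shows "finite (set_pmf (step_kernel \<Delta> z))"
proof (rule finite_subset)
  show "set_pmf (step_kernel \<Delta> z) \<subseteq> set (map fst (step_weights \<Delta> z))"
    unfolding step_kernel_def by (rule set_pmf_of_list[OF step_weights_wf[OF assms]])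
qed simp

text \<open>
  The difference of the coordinates is always even, so nothing is lost by recording half of it.
\<close>
definition half_gap_prob :: "real \<Rightarrow> nat \<Rightarrow> int \<Rightarrow> real" where
  "half_gap_prob \<Delta> n d =
     measure_pmf.expectation (chain_law (step_kernel \<Delta>) (0, 0) n) (\<lambda>(x, y). of_bool (x - y = 2 * d))"

lemma integrable_chain_law_step_kernel:
  fixes f :: "int \<times> int \<Rightarrow> real"
  assumes "\<Delta> \<ge> 0"
  shows "integrable (measure_pmf (chain_law (step_kernel \<Delta>) (0, 0) n)) f"
  by (intro integrable_measure_pmf_finite finite_set_pmf_chain_law finite_set_pmf_step_kernel assms)

text \<open>
  One step changes the mean of the product of the coordinates by the mean product of the increments,
  since each increment by itself is centred; that mean is \<open>u - 1\<close> on the diagonal and \<open>0\<close> elsewhere.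
\<close>
lemma expectation_product:
  assumes "\<Delta> \<ge> 0"
  shows "measure_pmf.expectation (chain_law (step_kernel \<Delta>) (0, 0) n)
      (\<lambda>z. real_of_int (fst z) * real_of_int (snd z)) =
    (u_par \<Delta> - 1) * (\<Sum>k<n. half_gap_prob \<Delta> k 0)"
proof (induction n)
  case (Suc n)
  note [simp] = integrable_chain_law_step_kernel[OF assms]
  have *: "measure_pmf.expectation (step_kernel \<Delta> z) (\<lambda>z. real_of_int (fst z) * real_of_int (snd z)) =
      real_of_int (fst z) * real_of_int (snd z)
      + (u_par \<Delta> - 1) * (case z of (x, y) \<Rightarrow> of_bool (x - y = 2 * 0))" for z
    by (cases z) (auto simp: expectation_step_kernel[OF assms] field_simps)
  show ?case
    using Suc
    by (simp add: expectation_chain_law_Suc finite_set_pmf_step_kernel assms * half_gap_prob_def[of _ n]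
      algebra_simps del: chain_law.simps)
qed simp

text \<open>
  The step of the lazy walk, corrected at the one point where the chain behaves differently: the
  correction has total mass \<open>0\<close> and is proportional to the mass that sits at \<open>0\<close>.
\<close>
lemma half_gap_prob_Suc:
  assumes "\<Delta> \<ge> 0"
  shows "half_gap_prob \<Delta> (Suc n) d =
    half_gap_prob \<Delta> n d / 2 + half_gap_prob \<Delta> n (d - 1) / 4 + half_gap_prob \<Delta> n (d + 1) / 4
    + (u_par \<Delta> - 1) * half_gap_prob \<Delta> n 0 * (of_bool (d = 0) / 2 - of_bool (\<bar>d\<bar> = 1) / 4)"
proof -
  note [simp] = integrable_chain_law_step_kernel[OF assms]
  define g :: "int \<Rightarrow> int \<times> int \<Rightarrow> real" where "g d = (\<lambda>(x, y). of_bool (x - y = 2 * d))" for d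
  have *: "measure_pmf.expectation (step_kernel \<Delta> z) (g d) =
      g d z / 2 + g (d - 1) z / 4 + g (d + 1) z / 4
      + (u_par \<Delta> - 1) * g 0 z * (of_bool (d = 0) / 2 - of_bool (\<bar>d\<bar> = 1) / 4)" for z
  proof (cases z)
    case (Pair x y)
    consider "d = 0" | "d = 1" | "d = -1" | "\<bar>d\<bar> > 1" by linarith
    then show ?thesis
      by cases (auto simp: Pair expectation_step_kernel[OF assms] g_def field_simps)
  qed
  show ?thesis
    unfolding half_gap_prob_def g_def[symmetric]
    by (simp add: expectation_chain_law_Suc finite_set_pmf_step_kernel assms *
      field_simps del: chain_law.simps)
qed

section \<open>Return probabilities of the lazy simple random walk\<close>

text \<open>
  The lower index ranges over the integers, which makes Pascal's rule hold without exceptions at the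
  two ends of a row.
\<close>
primrec signed_binomial :: "nat \<Rightarrow> int \<Rightarrow> real" where
  "signed_binomial 0 j = of_bool (j = 0)"
| "signed_binomial (Suc m) j = signed_binomial m j + signed_binomial m (j - 1)"

lemma signed_binomial_eq_0: "j < 0 \<Longrightarrow> signed_binomial m j = 0"
  by (induction m arbitrary: j) auto

lemma signed_binomial_nat: "signed_binomial m (int k) = real (m choose k)"
proof (induction m arbitrary: k)
  case 0
  then show ?case by (cases k) auto
next
  case (Suc m)
  show ?case
  proof (cases k)
    case 0
    then show ?thesis using Suc[of 0] by (simp add: signed_binomial_eq_0)
  next
    case (Suc l)
    then show ?thesis using Suc.IH[of l] Suc.IH[of "Suc l"] by simp
  qed
qed

text \<open>
  The lazy walk makes two fair half-steps at a time, whence the doubled row of Pascal's triangle.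
\<close>
definition lazy_walk_prob :: "nat \<Rightarrow> int \<Rightarrow> real" where
  "lazy_walk_prob n d = signed_binomial (2 * n) (int n + d) / 4 ^ n"

lemma lazy_walk_prob_Suc:
  "lazy_walk_prob (Suc n) d =
     lazy_walk_prob n d / 2 + lazy_walk_prob n (d - 1) / 4 + lazy_walk_prob n (d + 1) / 4"
  by (simp add: lazy_walk_prob_def field_simps)

definition return_prob :: "nat \<Rightarrow> real" where
  "return_prob n = real ((2 * n) choose n) / 4 ^ n"

lemma lazy_walk_prob_0: "lazy_walk_prob n 0 = return_prob n"
  by (simp add: lazy_walk_prob_def return_prob_def signed_binomial_nat)

lemma return_prob_0 [simp]: "return_prob 0 = 1"
  by (simp add: return_prob_def)

lemma return_prob_Suc: "(2 * real n + 2) * return_prob (Suc n) = (2 * real n + 1) * return_prob n"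
proof -
  have "Suc n * ((2 * Suc n) choose Suc n) = 2 * (2 * n + 1) * ((2 * n) choose n)"
  proof -
    have "(2 * Suc n) choose Suc n = 2 * (Suc (2 * n) choose Suc n)"
      using binomial_symmetric[of n "Suc (2 * n)"] by simp
    then show ?thesis
      using Suc_times_binomial_eq[of "2 * n" n] by (simp add: algebra_simps del: binomial_Suc_Suc)
  qed
  moreover define a b where "a = (2 * Suc n) choose Suc n" and "b = (2 * n) choose n"
  ultimately have "Suc n * a = 2 * (2 * n + 1) * b"
    by simp
  then have "real (Suc n * a) = real (2 * (2 * n + 1) * b)"
    by (rule arg_cong)
  then have "(real n + 1) * real a = (4 * real n + 2) * real b"
    by (simp add: algebra_simps)
  then have "(real n + 1) * real a * 2 / (4 * 4 ^ n) = (4 * real n + 2) * real b * 2 / (4 * 4 ^ n)"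
    by (simp only:)
  moreover have "(2 * real n + 2) * (real a / 4 ^ Suc n) = (real n + 1) * real a * 2 / (4 * 4 ^ n)"
    by (simp add: algebra_simps)
  moreover have "(4 * real n + 2) * real b * 2 / (4 * 4 ^ n) = (2 * real n + 1) * (real b / 4 ^ n)"
    by (simp add: field_simps)
  ultimately have "(2 * real n + 2) * (real a / 4 ^ Suc n) = (2 * real n + 1) * (real b / 4 ^ n)"
    by (simp only:)
  then show ?thesis
    by (simp only: return_prob_def a_def b_def)
qed

lemma return_prob_gbinomial: "return_prob n = (-1) ^ n * ((-1/2) gchoose n)"
proof (induction n)
  case (Suc n)
  have "real (Suc n) * ((-1/2::real) gchoose Suc n) = (-1/2 - real n) * ((-1/2) gchoose n)"
    using gbinomial_absorb_comp[of "-1/2::real" n] gbinomial_absorption'[of "Suc n" "-1/2::real"]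
     gbinomial_mult_1[of "-1/2::real" n] by (simp add: algebra_simps)
  then have "(2 * real n + 2) * ((-1/2::real) gchoose Suc n) = - (2 * real n + 1) * ((-1/2) gchoose n)"
    by (simp add: algebra_simps)
  then have "(2 * real n + 2) * ((-1) ^ Suc n * ((-1/2::real) gchoose Suc n)) =
     (2 * real n + 1) * ((-1) ^ n * ((-1/2) gchoose n))"
    by (simp only: mult.left_commute[of "2 * real n + 2"]) (simp add: algebra_simps)
  also have "\<dots> = (2 * real n + 2) * return_prob (Suc n)"
    using return_prob_Suc[of n] Suc by simp
  finally have "(2 * real n + 2) * ((-1) ^ Suc n * ((-1/2::real) gchoose Suc n)) =
     (2 * real n + 2) * return_prob (Suc n)" .
  moreover have "2 * real n + 2 \<noteq> 0" by linarith
  ultimately show ?case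
    by (simp only: mult_cancel_left) simp
qed simp

text \<open>
  Vandermonde's identity for the coefficients of \<open>(1 - z)\<close> to the power \<open>-1/2\<close>: the square of that
  series is the geometric series.
\<close>
lemma return_prob_convolution: "(\<Sum>k=0..n. return_prob k * return_prob (n - k)) = 1"
proof -
  have "(\<Sum>k=0..n. return_prob k * return_prob (n - k)) =
      (\<Sum>k=0..n. (-1) ^ n * (((-1/2) gchoose k) * ((-1/2) gchoose (n - k))))"
  proof (rule sum.cong)
    fix k assume "k \<in> {0..n}"
    then have "(-1::real) ^ k * (-1) ^ (n - k) = (-1) ^ n"
      by (simp add: power_add[symmetric])
    then show "return_prob k * return_prob (n - k) =
        (-1) ^ n * (((-1/2) gchoose k) * ((-1/2) gchoose (n - k)))"
      by (simp add: return_prob_gbinomial)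
  qed simp
  also have "\<dots> = (-1) ^ n * ((-1) gchoose n)"
    by (simp add: sum_distrib_left[symmetric] gbinomial_Vandermonde)
  also have "\<dots> = 1"
    using gbinomial_minus[of "1::real" n] by (simp add: power_add[symmetric] mult.assoc[symmetric] flip: binomial_gbinomial)
  finally show ?thesis .
qed

lemma return_prob_fps_square:
  "Abs_fps return_prob * Abs_fps return_prob * (1 - fps_X) = 1"
proof -
  have "Abs_fps return_prob * Abs_fps return_prob = Abs_fps (\<lambda>_. 1)"
    by (simp add: fps_eq_iff fps_mult_nth return_prob_convolution)
  moreover have "Abs_fps (\<lambda>_. 1) * (1 - fps_X) = (1 :: real fps)"
    by (simp add: fps_eq_iff right_diff_distrib fps_mult_fps_X_commute)
  ultimately show ?thesis by simp
qed

lemma sum_return_prob: "(\<Sum>k=1..n. return_prob k) = (2 * real n + 1) * return_prob n - 1"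
proof (induction n)
  case (Suc n)
  then show ?case
    using return_prob_Suc[of n] by (simp add: algebra_simps)
qed simp

lemma return_prob_asymptotic: "(\<lambda>n. sqrt (real n) * return_prob n) \<longlonglongrightarrow> 1 / sqrt pi"
proof -
  have "(\<lambda>n. ((-1/2::real) gchoose n) / ((-1)^n / exp ((-1/2+1) * of_real (ln (real n))))) \<longlonglongrightarrow>
      inverse (Gamma (- (-1/2)))"
    by (rule gbinomial_asymptotic)
  also have "inverse (Gamma (- (-1/2))) = 1 / sqrt pi"
    by (simp add: Gamma_one_half_real inverse_eq_divide)
  finally show ?thesis
  proof (rule Lim_transform_eventually)
    show "\<forall>\<^sub>F n in sequentially. ((-1/2::real) gchoose n) / ((-1)^n / exp ((-1/2+1) * of_real (ln (real n))))
       = sqrt (real n) * return_prob n"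
      using eventually_gt_at_top[of 0]
    proof eventually_elim
      case (elim n)
      then have "exp ((-1/2+1) * of_real (ln (real n))) = sqrt (real n)"
        using exp_ln[of "sqrt (real n)"] by (simp add: ln_sqrt)
      then show ?case
        unfolding return_prob_gbinomial by (cases "even n") simp_all
    qed
  qed
qed

text \<open>
  The sequence \<open>n q\<^sub>n\<^sup>2\<close> increases to its limit \<open>1/\<pi>\<close>; the shifted sequence
  \<open>(n + 1/2) q\<^sub>n\<^sup>2\<close>, used for the lower bound below, decreases to it.
\<close>
lemma return_prob_upper:
  assumes "n > 0"
  shows "return_prob n \<le> 1 / sqrt (pi * real n)"
proof -
  have "incseq (\<lambda>n. real n * (return_prob n)\<^sup>2)"
  proof (rule incseq_SucI)
    fix n
    have "return_prob (Suc n) = (2 * real n + 1) / (2 * real n + 2) * return_prob n"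
      using return_prob_Suc[of n] by (simp add: field_simps)
    then have "real (Suc n) * (return_prob (Suc n))\<^sup>2 =
        (real (Suc n) * ((2 * real n + 1) / (2 * real n + 2))\<^sup>2) * (return_prob n)\<^sup>2"
      by (simp add: power_mult_distrib power_divide)
    moreover have "real n \<le> real (Suc n) * ((2 * real n + 1) / (2 * real n + 2))\<^sup>2"
    proof -
      have "real n * (2 * real n + 2)\<^sup>2 \<le> real (Suc n) * (2 * real n + 1)\<^sup>2"
        by (simp add: power2_eq_square algebra_simps)
      moreover have "(2 * real n + 2)\<^sup>2 > 0" by simp
      ultimately show ?thesis
        by (simp only: power_divide times_divide_eq_right pos_le_divide_eq)
    qed
    ultimately show "real n * (return_prob n)\<^sup>2 \<le> real (Suc n) * (return_prob (Suc n))\<^sup>2"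
      by (simp only: mult_right_mono zero_le_power2)
  qed
  moreover have "(\<lambda>n. real n * (return_prob n)\<^sup>2) \<longlonglongrightarrow> 1 / pi"
    using tendsto_power[OF return_prob_asymptotic, of 2]
    by (simp add: power_mult_distrib power_divide)
  ultimately have "real n * (return_prob n)\<^sup>2 \<le> 1 / pi"
    by (rule incseq_le)
  then have "(return_prob n)\<^sup>2 \<le> (1 / sqrt (pi * real n))\<^sup>2"
    using assms by (simp add: power_divide field_simps)
  then show ?thesis
    by (rule power2_le_imp_le) simp
qed

lemma return_prob_lower: "1 / sqrt (pi * (real n + 1 / 2)) \<le> return_prob n"
proof -
  have "decseq (\<lambda>n. (real n + 1 / 2) * (return_prob n)\<^sup>2)"
  proof (rule decseq_SucI)
    fix n
    have "return_prob (Suc n) = (2 * real n + 1) / (2 * real n + 2) * return_prob n"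
      using return_prob_Suc[of n] by (simp add: field_simps)
    then have "(real (Suc n) + 1 / 2) * (return_prob (Suc n))\<^sup>2 =
        ((real (Suc n) + 1 / 2) * ((2 * real n + 1) / (2 * real n + 2))\<^sup>2) * (return_prob n)\<^sup>2"
      by (simp add: power_mult_distrib power_divide)
    moreover have "(real (Suc n) + 1 / 2) * ((2 * real n + 1) / (2 * real n + 2))\<^sup>2 \<le> real n + 1 / 2"
    proof -
      have "(real (Suc n) + 1 / 2) * (2 * real n + 1)\<^sup>2 \<le> (real n + 1 / 2) * (2 * real n + 2)\<^sup>2"
        by (simp add: power2_eq_square algebra_simps)
      moreover have "(2 * real n + 2)\<^sup>2 > 0" by simp
      ultimately show ?thesis
        by (simp only: power_divide times_divide_eq_right pos_divide_le_eq)
    qed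
    ultimately show "(real (Suc n) + 1 / 2) * (return_prob (Suc n))\<^sup>2
        \<le> (real n + 1 / 2) * (return_prob n)\<^sup>2"
      by (simp only: mult_right_mono zero_le_power2)
  qed
  moreover have "(\<lambda>n. (real n + 1 / 2) * (return_prob n)\<^sup>2) \<longlonglongrightarrow> 1 / pi"
  proof -
    have q: "(\<lambda>n. real n * (return_prob n)\<^sup>2) \<longlonglongrightarrow> 1 / pi"
      using tendsto_power[OF return_prob_asymptotic, of 2]
      by (simp add: power_mult_distrib power_divide)
    have "(\<lambda>n. (1 + 1 / (2 * real n)) * (real n * (return_prob n)\<^sup>2)) \<longlonglongrightarrow> (1 + 0) * (1 / pi)"
      by (intro tendsto_mult q) (real_asymp)
    then have "(\<lambda>n. (1 + 1 / (2 * real n)) * (real n * (return_prob n)\<^sup>2)) \<longlonglongrightarrow> 1 / pi"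
      by simp
    then show ?thesis
      by (rule Lim_transform_eventually)
         (use eventually_gt_at_top[of 0] in eventually_elim, simp add: field_simps)
  qed
  ultimately have "1 / pi \<le> (real n + 1 / 2) * (return_prob n)\<^sup>2"
    by (rule decseq_ge)
  then have "1 / pi / (real n + 1 / 2) \<le> (return_prob n)\<^sup>2"
    by (subst pos_divide_le_eq) (auto simp: mult.commute)
  then have "(1 / sqrt (pi * (real n + 1 / 2)))\<^sup>2 \<le> (return_prob n)\<^sup>2"
    by (simp add: power_divide)
  then show ?thesis
    by (rule power2_le_imp_le) (simp add: return_prob_def)
qed

section \<open>The recursion for the probability of being on the diagonal\<close>

text \<open>
  By Duhamel's principle the correction made at time \<open>k\<close> evolves as the unperturbed walk afterwards.
  Its profile is \<open>w\<^sub>0 - w\<^sub>1\<close>, where \<open>w\<^sub>m\<close> is the law of the unperturbed walk at time \<open>m\<close>, so at time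
  \<open>n\<close> it has become a difference of two consecutive laws of that walk.
\<close>
lemma half_gap_prob_superposition:
  assumes "\<Delta> \<ge> 0"
  shows "half_gap_prob \<Delta> n d = lazy_walk_prob n d + (u_par \<Delta> - 1) *
    (\<Sum>k<n. half_gap_prob \<Delta> k 0 * (lazy_walk_prob (n - Suc k) d - lazy_walk_prob (n - k) d))"
proof (induction n arbitrary: d)
  case 0
  show ?case
    by (simp add: half_gap_prob_def lazy_walk_prob_def)
next
  case (Suc n)
  define w where "w = lazy_walk_prob"
  define c where "c = u_par \<Delta> - 1"
  define p where "p k = half_gap_prob \<Delta> k 0" for k
  define s where "s n d = (\<Sum>k<n. p k * (w (n - Suc k) d - w (n - k) d))" for n d
  have IH: "half_gap_prob \<Delta> n d = w n d + c * s n d" for d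
    using Suc by (simp add: w_def c_def p_def s_def)
  have "s n d / 2 + s n (d - 1) / 4 + s n (d + 1) / 4 =
      (\<Sum>k<n. p k * (w (Suc (n - Suc k)) d - w (Suc (n - k)) d))"
    unfolding s_def w_def lazy_walk_prob_Suc sum_divide_distrib sum.distrib[symmetric]
    by (intro sum.cong) (auto simp: field_simps)
  also have "\<dots> = (\<Sum>k<n. p k * (w (Suc n - Suc k) d - w (Suc n - k) d))"
    by (intro sum.cong) (auto simp: Suc_diff_Suc Suc_diff_le)
  finally have s: "s (Suc n) d = s n d / 2 + s n (d - 1) / 4 + s n (d + 1) / 4 + p n * (w 0 d - w 1 d)"
    by (simp add: s_def)
  have k: "w 0 d - w 1 d = of_bool (d = 0) / 2 - of_bool (\<bar>d\<bar> = 1) / 4"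
    unfolding One_nat_def w_def lazy_walk_prob_Suc by (auto simp: lazy_walk_prob_def)
  have w: "w (Suc n) d = w n d / 2 + w n (d - 1) / 4 + w n (d + 1) / 4"
    unfolding w_def by (rule lazy_walk_prob_Suc)
  have h: "half_gap_prob \<Delta> (Suc n) d =
      half_gap_prob \<Delta> n d / 2 + half_gap_prob \<Delta> n (d - 1) / 4 + half_gap_prob \<Delta> n (d + 1) / 4
      + c * p n * (w 0 d - w 1 d)"
    unfolding k c_def p_def by (rule half_gap_prob_Suc[OF assms])
  have "half_gap_prob \<Delta> (Suc n) d = w (Suc n) d + c * s (Suc n) d"
    unfolding h IH s w by (simp add: algebra_simps add_divide_distrib)
  then show ?case by (simp add: w_def c_def p_def s_def)
qed

text \<open>
  In terms of generating functions the hypothesis is \<open>P (e + (1 - e) (1 - z) Q) = Q\<close>. Multiplication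
  by \<open>Q\<close> gives \<open>P (e Q + 1 - e) = Q\<^sup>2\<close> in view of \<open>(1 - z) Q\<^sup>2 = 1\<close>, and multiplication by
  \<open>(1 - e - e Q) (1 - z)\<close> then gives \<open>P ((1 - e)\<^sup>2 (1 - z) - e\<^sup>2) = 1 - e - e Q\<close>, whose coefficient
  of order \<open>n + 1\<close> is the claim.
\<close>
lemma perturbed_renewal_recursion:
  fixes p :: "nat \<Rightarrow> real"
  assumes ren: "\<And>n. p n = return_prob n
      + (1 - e) * (\<Sum>k<n. p k * (return_prob (n - Suc k) - return_prob (n - k)))"
  shows "(1 - 2 * e) * p (Suc n) = (1 - e)\<^sup>2 * p n - e * return_prob (Suc n)"
proof -
  define P where "P = Abs_fps p"
  define Q where "Q = Abs_fps return_prob"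
  define E where "E = fps_const e"
  have 1: "P = Q + (1 - E) * P * (fps_X * Q - Q + 1)"
  proof (rule fps_ext)
    fix n
    have "fps_nth (P * (fps_X * Q - Q + 1)) n =
        (\<Sum>k=0..n. p k * fps_nth (fps_X * Q - Q + 1) (n - k))"
      by (simp add: fps_mult_nth P_def)
    also have "\<dots> = (\<Sum>k\<in>{..<n} \<union> {n}. p k * fps_nth (fps_X * Q - Q + 1) (n - k))"
      by (intro sum.cong) auto
    also have "\<dots> = (\<Sum>k<n. p k * fps_nth (fps_X * Q - Q + 1) (n - k))"
      by (simp add: Q_def)
    also have "\<dots> = (\<Sum>k<n. p k * (return_prob (n - Suc k) - return_prob (n - k)))"
      by (intro sum.cong) (auto simp: Q_def)
    finally show "fps_nth P n = fps_nth (Q + (1 - E) * P * (fps_X * Q - Q + 1)) n"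
      using ren[of n]
      by (simp add: E_def mult.assoc P_def Q_def fps_const_1_eq_1[symmetric] del: fps_const_1_eq_1)
  qed
  have 2: "Q * Q * (1 - fps_X) = 1"
    unfolding Q_def by (rule return_prob_fps_square)
  have "P * (E * Q + (1 - E) * (Q * Q * (1 - fps_X))) = Q * Q"
  proof -
    have "P * (E + (1 - E) * (1 - fps_X) * Q) = Q"
      using 1 by (simp add: algebra_simps)
    then have "(P * (E + (1 - E) * (1 - fps_X) * Q)) * Q = Q * Q" by simp
    then show ?thesis by (simp add: algebra_simps)
  qed
  then have "P * (E * Q + (1 - E)) = Q * Q" by (simp add: 2)
  then have "P * (E * Q + (1 - E)) * ((1 - E) - E * Q) * (1 - fps_X)
      = Q * Q * (1 - fps_X) * ((1 - E) - E * Q)"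
    by (simp add: mult_ac)
  moreover have "P * (E * Q + (1 - E)) * ((1 - E) - E * Q) * (1 - fps_X) =
      P * ((1 - E)\<^sup>2 * (1 - fps_X) - E\<^sup>2 * (Q * Q * (1 - fps_X)))"
    by algebra
  ultimately have 3: "P * ((1 - E)\<^sup>2 * (1 - fps_X) - E\<^sup>2) = (1 - E) - E * Q"
    by (simp add: 2)
  have c: "1 - E = fps_const (1 - e)"
    by (simp add: E_def fps_const_1_eq_1[symmetric] del: fps_const_1_eq_1)
  have "P * ((1 - E)\<^sup>2 * (1 - fps_X) - E\<^sup>2) =
      fps_const ((1 - e)\<^sup>2) * (P - fps_X * P) - fps_const (e\<^sup>2) * P"
    unfolding c by (simp add: E_def fps_const_power algebra_simps)
  then have "fps_nth (fps_const ((1 - e)\<^sup>2) * (P - fps_X * P) - fps_const (e\<^sup>2) * P) (Suc n)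
      = fps_nth ((1 - E) - E * Q) (Suc n)"
    using 3 by simp
  then have "(1 - e)\<^sup>2 * (p (Suc n) - p n) - e\<^sup>2 * p (Suc n) = - e * return_prob (Suc n)"
    unfolding c by (simp add: P_def Q_def E_def)
  then show ?thesis by (simp add: algebra_simps power2_eq_square)
qed

lemma meeting_prob_recursion:
  assumes "\<Delta> \<ge> 0"
  shows "(1 - 2 * (2 - u_par \<Delta>)) * half_gap_prob \<Delta> (Suc n) 0 =
    (1 - (2 - u_par \<Delta>))\<^sup>2 * half_gap_prob \<Delta> n 0 - (2 - u_par \<Delta>) * return_prob (Suc n)"
proof (rule perturbed_renewal_recursion)
  show "half_gap_prob \<Delta> n 0 = return_prob n + (1 - (2 - u_par \<Delta>)) *
      (\<Sum>k<n. half_gap_prob \<Delta> k 0 * (return_prob (n - Suc k) - return_prob (n - k)))" for n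
    using half_gap_prob_superposition[OF assms, of n 0] by (simp add: lazy_walk_prob_0)
qed

text \<open>
  The coefficients of \<open>p\<^sub>n\<^sub>+\<^sub>1\<close> and \<open>p\<^sub>n\<close> in the recursion differ exactly by \<open>e\<^sup>2\<close>, so telescoping
  leaves \<open>e\<^sup>2\<close> times the sum of the \<open>p\<^sub>k\<close>.
\<close>
lemma recursion_sum:
  fixes p :: "nat \<Rightarrow> real"
  assumes "p 0 = 1" and rec: "\<And>n. (1 - 2 * e) * p (Suc n) = (1 - e)\<^sup>2 * p n - e * return_prob (Suc n)"
  shows "e\<^sup>2 * (\<Sum>k<n. p k) = (1 - 2 * e) * (p n - 1) + e * (\<Sum>k=1..n. return_prob k)"
proof (induction n)
  case (Suc n)
  then show ?case using rec[of n] by (simp add: algebra_simps power2_eq_square)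
qed (simp add: assms)

lemma recursion_solution:
  fixes p :: "nat \<Rightarrow> real"
  assumes "p 0 = 1" and rec: "\<And>n. (1 - 2 * e) * p (Suc n) = (1 - e)\<^sup>2 * p n - e * return_prob (Suc n)"
    and "e < 1 / 2" and r: "r = (1 - e)\<^sup>2 / (1 - 2 * e)"
  shows "p n = r ^ n * (1 - e / (1 - 2 * e) * (\<Sum>k=1..n. return_prob k / r ^ k))"
proof (induction n)
  case (Suc n)
  have r0: "r > 0" using assms by (simp add: r)
  have "p (Suc n) = ((1 - e)\<^sup>2 * p n - e * return_prob (Suc n)) / (1 - 2 * e)"
    using rec[of n] \<open>e < 1/2\<close> by (simp add: eq_divide_eq mult.commute)
  then have "p (Suc n) = r * p n - e / (1 - 2 * e) * return_prob (Suc n)"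
    by (simp add: r diff_divide_distrib)
  also have "r * p n = r ^ Suc n * (1 - e / (1 - 2 * e) * (\<Sum>k=1..n. return_prob k / r ^ k))"
    using Suc by simp
  also have "e / (1 - 2 * e) * return_prob (Suc n) =
      r ^ Suc n * (e / (1 - 2 * e) * (return_prob (Suc n) / r ^ Suc n))"
    using r0 by simp
  finally show ?case
    by (simp only: right_diff_distrib distrib_left sum.nat_ivl_Suc' le_add2 Suc_eq_plus1[symmetric])
qed (simp add: assms)

section \<open>The complementary error function\<close>

lemma has_real_derivative_erfc:
  "(erfc has_real_derivative - (2 / sqrt pi * exp (- (x ^ 2)))) (at x)"
proof -
  (* the fundamental theorem is stated on a compact interval, and x has to be interior to it *)
  define R where "R = \<bar>x\<bar> + 1"
  have "((\<lambda>u. LBINT y=0..u. exp (- (y ^ 2))) has_vector_derivative exp (- (x ^ 2))) (at x within {-R..R})"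
    unfolding zero_ereal_def
    by (rule interval_integral_FTC2) (auto simp: R_def intro!: continuous_intros)
  then have "((\<lambda>u. LBINT y=0..u. exp (- (y ^ 2))) has_real_derivative exp (- (x ^ 2))) (at x within {-R..R})"
    by (simp add: has_real_derivative_iff_has_vector_derivative)
  moreover have "at x within {-R..R} = at x"
    by (rule at_within_interior) (auto simp: R_def)
  ultimately have "((\<lambda>u. LBINT y=0..u. exp (- (y ^ 2))) has_real_derivative exp (- (x ^ 2))) (at x)"
    by simp
  from DERIV_diff[OF DERIV_const[of 1] DERIV_cmult[OF this, of "2 / sqrt pi"]]
  show ?thesis
    by (simp add: erfc_def[abs_def])
qed

lemma erfc_0 [simp]: "erfc 0 = 1"
  by (simp add: erfc_def interval_integral_endpoints_same flip: zero_ereal_def)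

lemma continuous_on_erfc [continuous_intros]:
  assumes "continuous_on A f"
  shows "continuous_on A (\<lambda>x. erfc (f x))"
proof -
  have "continuous_on UNIV erfc"
    by (rule DERIV_continuous_on[OF has_real_derivative_erfc[THEN DERIV_subset]]) auto
  from continuous_on_compose2[OF this assms] show ?thesis by auto
qed

lemma tendsto_erfc [tendsto_intros]:
  "(f \<longlongrightarrow> x) F \<Longrightarrow> ((\<lambda>t. erfc (f t)) \<longlongrightarrow> erfc x) F"
  by (rule isCont_tendsto_compose[OF DERIV_isCont[OF has_real_derivative_erfc]])

lemma has_real_derivative_erfc_sqrt:
  assumes "x > 0"
  shows "((\<lambda>x. erfc (a * sqrt x)) has_real_derivative - (a * exp (- (a\<^sup>2 * x)) / sqrt (pi * x))) (at x)"
proof -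
  have "((\<lambda>x. a * sqrt x) has_real_derivative a * (inverse (sqrt x) / 2)) (at x)"
    using assms by (intro DERIV_cmult DERIV_real_sqrt)
  from DERIV_chain2[OF has_real_derivative_erfc this]
  show ?thesis
    using assms by (simp add: power_mult_distrib real_sqrt_mult field_simps)
qed

lemma erfc_sqrt_mvt:
  assumes "0 \<le> x" "x < y"
  obtains z where "x < z" "z < y"
    "erfc (a * sqrt x) - erfc (a * sqrt y) = (y - x) * (a * exp (- (a\<^sup>2 * z)) / sqrt (pi * z))"
proof -
  have cont: "continuous_on {x..y} (\<lambda>x. erfc (a * sqrt x))"
    by (intro continuous_intros)
  have deriv: "((\<lambda>x. erfc (a * sqrt x)) has_derivative
      (*) (- (a * exp (- (a\<^sup>2 * z)) / sqrt (pi * z)))) (at z)" if "x < z" "z < y" for z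
    using has_real_derivative_erfc_sqrt[of z a] that assms
    unfolding has_field_derivative_def by simp
  obtain z where "x < z" "z < y" "erfc (a * sqrt y) - erfc (a * sqrt x) =
      - (a * exp (- (a\<^sup>2 * z)) / sqrt (pi * z)) * (y - x)"
    using mvt[OF \<open>x < y\<close> cont deriv] by blast
  then show ?thesis
    by (intro that[of z]) (auto simp: algebra_simps)
qed

text \<open>
  The derivative of \<open>exp (c\<^sup>2 s) erfc (c sqrt s)\<close> is \<open>c\<^sup>2\<close> times the integrand minus \<open>c / sqrt (\<pi> s)\<close>,
  and adding \<open>2 c sqrt s / sqrt \<pi>\<close> cancels the last term. That antiderivative is not
  differentiable at \<open>0\<close>, which is why the version of the fundamental theorem with limits at the end
  points is used.
\<close>
lemma integral_exp_erfc:
  assumes "c > 0"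
  shows "(LBINT s=0..1. exp (c\<^sup>2 * s) * erfc (c * sqrt s)) =
    (exp (c\<^sup>2) * erfc c - 1 + 2 * c / sqrt pi) / c\<^sup>2"
proof -
  define f where "f s = exp (c\<^sup>2 * s) * erfc (c * sqrt s)" for s
  define F where "F s = (f s + 2 * c / sqrt pi * sqrt s) / c\<^sup>2" for s
  have contf: "continuous_on A f" and contF: "continuous_on A F" for A
    unfolding f_def F_def using assms by (intro continuous_intros; simp)+
  have limF: "(F \<longlongrightarrow> F x) (at x within A)" for x A
    using contF[of UNIV] by (auto simp: continuous_on_def intro: tendsto_within_subset)
  have deriv: "(F has_real_derivative f s) (at s)" if "s > 0" for s
  proof -
    have "((\<lambda>s. exp (c\<^sup>2 * s)) has_real_derivative exp (c\<^sup>2 * s) * c\<^sup>2) (at s)"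
      by (auto intro!: derivative_eq_intros)
    then have "(F has_real_derivative (exp (c\<^sup>2 * s) * c\<^sup>2 * erfc (c * sqrt s)
        + - (c * exp (- (c\<^sup>2 * s)) / sqrt (pi * s)) * exp (c\<^sup>2 * s)
        + 2 * c / sqrt pi * (inverse (sqrt s) / 2)) / c\<^sup>2) (at s)"
      unfolding F_def f_def
      by (intro DERIV_cdivide DERIV_add DERIV_mult DERIV_cmult DERIV_real_sqrt
          has_real_derivative_erfc_sqrt that)
    moreover have "- (c * exp (- (c\<^sup>2 * s)) / sqrt (pi * s)) * exp (c\<^sup>2 * s) = - (c / sqrt (pi * s))"
      by (simp add: exp_minus)
    ultimately show ?thesis
      using that assms by (simp add: f_def real_sqrt_mult field_simps)
  qed
  have "(LBINT s=ereal 0..ereal 1. f s) = F 1 - F 0"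
  proof (rule interval_integral_FTC_integrable)
    show "set_integrable lborel (einterval (ereal 0) (ereal 1)) f"
      by (rule set_integrable_subset[OF borel_integrable_atLeastAtMost'[OF contf, of 0 1]]) auto
    show "((F \<circ> real_of_ereal) \<longlongrightarrow> F 0) (at_right (ereal 0))"
      unfolding ereal_tendsto_simps
      by (rule limF)
    show "((F \<circ> real_of_ereal) \<longlongrightarrow> F 1) (at_left (ereal 1))"
      unfolding ereal_tendsto_simps
      by (rule limF)
    show "isCont f x" for x
      using contf[of UNIV] by (simp add: continuous_on_eq_continuous_at)
  qed (auto simp: deriv simp flip: has_real_derivative_iff_has_vector_derivative)
  moreover have "F 1 - F 0 = (exp (c\<^sup>2) * erfc c - 1 + 2 * c / sqrt pi) / c\<^sup>2"
    by (simp add: F_def f_def diff_divide_distrib add_divide_distrib)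
  ultimately show ?thesis
    by (simp add: f_def zero_ereal_def one_ereal_def)
qed

section \<open>The scaling limit\<close>

text \<open>
  The function \<open>a exp (- a\<^sup>2 x) / sqrt (\<pi> x)\<close> decreases in \<open>x > 0\<close> and is minus the derivative of
  \<open>erfc (a sqrt x)\<close>. The upper bound on \<open>q\<^sub>k\<close> makes the \<open>k\<close>-th term at most the value of this function
  at \<open>k\<close>, hence at most its integral over \<open>[k - 1, k]\<close>; these integrals telescope.
\<close>
lemma return_prob_exp_sum_upper:
  assumes "a > 0"
  shows "a * (\<Sum>k=1..n. return_prob k * exp (- (a\<^sup>2 * real k))) \<le> 1 - erfc (a * sqrt (real n))"
proof (induction n)
  case (Suc n)
  obtain z where z: "real n < z" "z < real (Suc n)" and
    eq: "erfc (a * sqrt (real n)) - erfc (a * sqrt (real (Suc n))) =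
      (real (Suc n) - real n) * (a * exp (- (a\<^sup>2 * z)) / sqrt (pi * z))"
    by (rule erfc_sqrt_mvt[of "real n" "real (Suc n)" a]) auto
  have "a * (return_prob (Suc n) * exp (- (a\<^sup>2 * real (Suc n)))) \<le>
      a * (1 / sqrt (pi * real (Suc n)) * exp (- (a\<^sup>2 * real (Suc n))))"
    using assms return_prob_upper[of "Suc n"] by (intro mult_left_mono mult_right_mono) auto
  also have "\<dots> \<le> a * (1 / sqrt (pi * z) * exp (- (a\<^sup>2 * z)))"
    using assms z by (intro mult_left_mono mult_mono divide_left_mono) auto
  finally show ?case
    using Suc eq by (simp add: algebra_simps)
qed simp

text \<open>
  The lower bound on \<open>q\<^sub>k\<close> involves \<open>k + 1/2\<close>, so here the \<open>k\<close>-th term is compared with the integral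
  over \<open>[k + 1/2, k + 3/2]\<close>. The shift by \<open>3/2\<close> disappears in the limit \<open>a \<rightarrow> 0\<close>.
\<close>
lemma return_prob_exp_sum_lower:
  assumes "a > 0"
  shows "erfc (a * sqrt (3 / 2)) - erfc (a * sqrt (real n + 3 / 2)) \<le>
    a * (\<Sum>k=1..n. return_prob k * exp (- (a\<^sup>2 * real k)))"
proof (induction n)
  case (Suc n)
  let ?k = "real (Suc n)"
  obtain z where z: "?k + 1 / 2 < z" "z < ?k + 3 / 2" and
    eq: "erfc (a * sqrt (?k + 1 / 2)) - erfc (a * sqrt (?k + 3 / 2)) =
      ((?k + 3 / 2) - (?k + 1 / 2)) * (a * exp (- (a\<^sup>2 * z)) / sqrt (pi * z))"
    by (rule erfc_sqrt_mvt[of "?k + 1 / 2" "?k + 3 / 2" a]) auto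
  have "a * (1 / sqrt (pi * z) * exp (- (a\<^sup>2 * z))) \<le>
      a * (1 / sqrt (pi * (?k + 1 / 2)) * exp (- (a\<^sup>2 * ?k)))"
    using assms z by (intro mult_left_mono mult_mono divide_left_mono) auto
  also have "\<dots> \<le> a * (return_prob (Suc n) * exp (- (a\<^sup>2 * ?k)))"
    using assms return_prob_lower[of "Suc n"] by (intro mult_left_mono mult_right_mono) auto
  moreover have "?k + 1 / 2 = real n + 3 / 2" by simp
  ultimately show ?case
    using Suc eq by (simp add: algebra_simps)
qed simp

lemma tendsto_0_of_sqrt_scaled:
  fixes e :: "nat \<Rightarrow> real"
  assumes "(\<lambda>n. e n * sqrt (real n)) \<longlonglongrightarrow> c"
  shows "e \<longlonglongrightarrow> 0"
proof -
  have "(\<lambda>n. e n * sqrt (real n) * (1 / sqrt (real n))) \<longlonglongrightarrow> c * 0"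
    by (intro tendsto_mult assms) real_asymp
  then have "(\<lambda>n. e n * sqrt (real n) * (1 / sqrt (real n))) \<longlonglongrightarrow> 0"
    by simp
  then show ?thesis
    by (rule Lim_transform_eventually)
       (use eventually_gt_at_top[of 0] in eventually_elim, simp)
qed

text \<open>
  In the solution of the recursion, \<open>r = 1 + x\<close> with \<open>x = e\<^sup>2 / (1 - 2 e) \<sim> c\<^sup>2 / n\<close>, and the weights
  \<open>1 / r^k\<close> become \<open>exp (- a\<^sup>2 k)\<close> for \<open>a = sqrt (ln r) \<sim> c / sqrt n\<close>. Since also \<open>e \<sim> c / sqrt n\<close>,
  the prefactor \<open>e / (1 - 2 e)\<close> may be exchanged for \<open>a\<close>, for which the bounds above squeeze the
  weighted sum of return probabilities to \<open>1 - erfc c\<close>.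
\<close>
lemma recursion_limit:
  fixes e :: "nat \<Rightarrow> real" and p :: "nat \<Rightarrow> nat \<Rightarrow> real"
  assumes e_pos: "\<And>n. e n > 0" and c: "c > 0"
    and e_lim: "(\<lambda>n. e n * sqrt (real n)) \<longlonglongrightarrow> c"
    and p0: "\<And>n. p n 0 = 1"
    and rec: "\<And>n m. (1 - 2 * e n) * p n (Suc m) = (1 - e n)\<^sup>2 * p n m - e n * return_prob (Suc m)"
  shows "(\<lambda>n. p n n) \<longlonglongrightarrow> exp (c\<^sup>2) * erfc c"
proof -
  have e0: "e \<longlonglongrightarrow> 0"
    by (rule tendsto_0_of_sqrt_scaled[OF e_lim])
  have small: "\<forall>\<^sub>F n in sequentially. e n < 1 / 2"
    using e0 by (rule order_tendstoD) simp
  define x where "x n = (e n)\<^sup>2 / (1 - 2 * e n)" for n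
  define a where "a n = sqrt (ln (1 + x n))" for n
  have x_pos: "\<forall>\<^sub>F n in sequentially. x n > 0"
    using small by eventually_elim (use e_pos in \<open>auto simp: x_def intro!: divide_pos_pos zero_less_power\<close>)
  have x0: "x \<longlonglongrightarrow> 0"
    unfolding x_def using tendsto_divide[OF tendsto_power[OF e0, of 2] tendsto_diff[OF tendsto_const[of 1] tendsto_mult[OF tendsto_const[of 2] e0]]]
    by simp
  have nx: "(\<lambda>n. real n * x n) \<longlonglongrightarrow> c\<^sup>2"
  proof -
    have "(\<lambda>n. (e n * sqrt (real n))\<^sup>2 / (1 - 2 * e n)) \<longlonglongrightarrow> c\<^sup>2 / (1 - 2 * 0)"
      by (intro tendsto_intros e_lim e0) simp
    then show ?thesis
      by (simp add: x_def power_mult_distrib mult.commute)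
  qed
  have lnx: "(\<lambda>n. ln (1 + x n) / x n) \<longlonglongrightarrow> 1"
  proof -
    have "((\<lambda>x::real. ln (1 + x) / x) \<longlongrightarrow> 1) (at 0)"
      by real_asymp
    moreover have "filterlim x (at 0) sequentially"
      using x0 x_pos by (auto simp: filterlim_at elim: eventually_mono)
    ultimately show ?thesis by (rule filterlim_compose)
  qed
  have nln: "(\<lambda>n. real n * ln (1 + x n)) \<longlonglongrightarrow> c\<^sup>2"
  proof -
    have "(\<lambda>n. (real n * x n) * (ln (1 + x n) / x n)) \<longlonglongrightarrow> c\<^sup>2 * 1"
      by (intro tendsto_mult nx lnx)
    then have "(\<lambda>n. (real n * x n) * (ln (1 + x n) / x n)) \<longlonglongrightarrow> c\<^sup>2"
      by (simp only: mult_1_right)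
    then show ?thesis
      by (rule Lim_transform_eventually) (use x_pos in eventually_elim, simp)
  qed
  have a_sqrt: "(\<lambda>n. a n * sqrt (real n)) \<longlonglongrightarrow> c"
    using tendsto_real_sqrt[OF nln] c by (simp add: a_def real_sqrt_mult mult.commute)
  have a_pos: "\<forall>\<^sub>F n in sequentially. a n > 0"
    using x_pos by eventually_elim (simp add: a_def)
  have a0: "a \<longlonglongrightarrow> 0"
    unfolding a_def using tendsto_real_sqrt[OF tendsto_ln[OF tendsto_add[OF tendsto_const[of 1] x0]]]
    by simp
  define T where "T n = a n * (\<Sum>k=1..n. return_prob k * exp (- ((a n)\<^sup>2 * real k)))" for n
  have T: "T \<longlonglongrightarrow> 1 - erfc c"
  proof (rule tendsto_sandwich)
    show "\<forall>\<^sub>F n in sequentially. erfc (a n * sqrt (3 / 2)) - erfc (a n * sqrt (real n + 3 / 2)) \<le> T n"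
      using a_pos by eventually_elim (simp only: T_def return_prob_exp_sum_lower)
    show "\<forall>\<^sub>F n in sequentially. T n \<le> 1 - erfc (a n * sqrt (real n))"
      using a_pos by eventually_elim (simp only: T_def return_prob_exp_sum_upper)
    show "(\<lambda>n. 1 - erfc (a n * sqrt (real n))) \<longlonglongrightarrow> 1 - erfc c"
      by (intro tendsto_intros a_sqrt)
    have "(\<lambda>n. (a n * sqrt (real n)) * sqrt (1 + 3 / 2 / real n)) \<longlonglongrightarrow> c * 1"
      by (intro tendsto_mult a_sqrt) real_asymp
    then have "(\<lambda>n. a n * sqrt (real n + 3 / 2)) \<longlonglongrightarrow> c"
      by (simp, elim Lim_transform_eventually)
         (use eventually_gt_at_top[of 0] in eventually_elim,
          simp add: mult.assoc field_simps flip: real_sqrt_mult)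
    then have "(\<lambda>n. erfc (a n * sqrt (3 / 2)) - erfc (a n * sqrt (real n + 3 / 2)))
        \<longlonglongrightarrow> erfc (0 * sqrt (3 / 2)) - erfc c"
      by (intro tendsto_intros a0)
    then show "(\<lambda>n. erfc (a n * sqrt (3 / 2)) - erfc (a n * sqrt (real n + 3 / 2)))
        \<longlonglongrightarrow> 1 - erfc c" by simp
  qed
  have ratio: "(\<lambda>n. e n / (1 - 2 * e n) / a n) \<longlonglongrightarrow> 1"
  proof -
    have "(\<lambda>n. (e n * sqrt (real n)) / (1 - 2 * e n) / (a n * sqrt (real n))) \<longlonglongrightarrow> c / (1 - 2 * 0) / c"
      by (intro tendsto_intros e_lim e0 a_sqrt) (use c in auto)
    then have "(\<lambda>n. (e n * sqrt (real n)) / (1 - 2 * e n) / (a n * sqrt (real n))) \<longlonglongrightarrow> 1"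
      using c by simp
    then show ?thesis
      by (rule Lim_transform_eventually)
         (use eventually_gt_at_top[of 0] in eventually_elim, simp)
  qed
  have "(\<lambda>n. exp (real n * ln (1 + x n)) * (1 - e n / (1 - 2 * e n) / a n * T n))
      \<longlonglongrightarrow> exp (c\<^sup>2) * (1 - 1 * (1 - erfc c))"
    by (intro tendsto_intros nln ratio T)
  then have "(\<lambda>n. exp (real n * ln (1 + x n)) * (1 - e n / (1 - 2 * e n) / a n * T n))
      \<longlonglongrightarrow> exp (c\<^sup>2) * erfc c" by simp
  then show ?thesis
  proof (rule Lim_transform_eventually)
    show "\<forall>\<^sub>F n in sequentially. exp (real n * ln (1 + x n)) * (1 - e n / (1 - 2 * e n) / a n * T n) = p n n"
      using small x_pos a_pos
    proof eventually_elim
      case (elim n)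
      have r: "1 + x n = (1 - e n)\<^sup>2 / (1 - 2 * e n)"
        using elim(1) by (simp add: x_def field_simps power2_eq_square)
      have pw: "(1 + x n) ^ k = exp (real k * ln (1 + x n))" for k
        using elim by (simp add: exp_of_nat_mult)
      have "(a n)\<^sup>2 = ln (1 + x n)"
        using elim by (simp add: a_def)
      then have "return_prob k * exp (- ((a n)\<^sup>2 * real k)) = return_prob k / (1 + x n) ^ k" for k
        unfolding pw by (simp only: exp_minus divide_inverse mult.commute[of "ln _"])
      then have "T n = a n * (\<Sum>k=1..n. return_prob k / (1 + x n) ^ k)"
        by (simp only: T_def)
      then have "e n / (1 - 2 * e n) / a n * T n =
          e n / (1 - 2 * e n) * (\<Sum>k=1..n. return_prob k / (1 + x n) ^ k)"
        using elim by (simp only: times_divide_eq_left) simp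
      moreover have "p n n = (1 + x n) ^ n *
          (1 - e n / (1 - 2 * e n) * (\<Sum>k=1..n. return_prob k / (1 + x n) ^ k))"
        by (rule recursion_solution[OF p0 rec elim(1) r])
      ultimately show ?case
        by (simp only: pw)
    qed
  qed
qed

text \<open>
  As \<open>n e\<^sup>2\<close> tends to \<open>c\<^sup>2\<close>, the identity for \<open>e\<^sup>2 (p\<^sub>0 + \<dots> + p\<^sub>n\<^sub>-\<^sub>1)\<close> turns the limit of \<open>p\<^sub>n\<close> into
  that of the average. The term \<open>2 c / sqrt \<pi>\<close> is the limit of \<open>e (q\<^sub>1 + \<dots> + q\<^sub>n)\<close>, because
  \<open>q\<^sub>1 + \<dots> + q\<^sub>n = (2 n + 1) q\<^sub>n - 1\<close>.
\<close>
lemma recursion_average_limit: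
  fixes e :: "nat \<Rightarrow> real" and p :: "nat \<Rightarrow> nat \<Rightarrow> real"
  assumes e_pos: "\<And>n. e n > 0" and c: "c > 0"
    and e_lim: "(\<lambda>n. e n * sqrt (real n)) \<longlonglongrightarrow> c"
    and p0: "\<And>n. p n 0 = 1"
    and rec: "\<And>n m. (1 - 2 * e n) * p n (Suc m) = (1 - e n)\<^sup>2 * p n m - e n * return_prob (Suc m)"
  shows "(\<lambda>n. (\<Sum>k<n. p n k) / real n) \<longlonglongrightarrow> (exp (c\<^sup>2) * erfc c - 1 + 2 * c / sqrt pi) / c\<^sup>2"
proof -
  have e0: "e \<longlonglongrightarrow> 0"
    by (rule tendsto_0_of_sqrt_scaled[OF e_lim])
  have "(\<lambda>n. (1 + 1 / (2 * real n)) * (2 * (e n * sqrt (real n)) * (sqrt (real n) * return_prob n)))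
      \<longlonglongrightarrow> (1 + 0) * (2 * c * (1 / sqrt pi))"
    by (intro tendsto_mult tendsto_const e_lim return_prob_asymptotic) real_asymp
  then have "(\<lambda>n. (1 + 1 / (2 * real n)) * (2 * (e n * sqrt (real n)) * (sqrt (real n) * return_prob n)))
      \<longlonglongrightarrow> 2 * c / sqrt pi" by simp
  then have Q: "(\<lambda>n. e n * ((2 * real n + 1) * return_prob n)) \<longlonglongrightarrow> 2 * c / sqrt pi"
  proof (rule Lim_transform_eventually)
    show "\<forall>\<^sub>F n in sequentially.
        (1 + 1 / (2 * real n)) * (2 * (e n * sqrt (real n)) * (sqrt (real n) * return_prob n)) =
        e n * ((2 * real n + 1) * return_prob n)"
      using eventually_gt_at_top[of 0]
    proof eventually_elim
      case (elim n)
      have "(1 + 1 / (2 * real n)) * (2 * (e n * sqrt (real n)) * (sqrt (real n) * return_prob n)) =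
          (1 + 1 / (2 * real n)) * (2 * e n * return_prob n * (sqrt (real n))\<^sup>2)"
        by (simp add: power2_eq_square)
      also have "\<dots> = e n * ((2 * real n + 1) * return_prob n)"
        using elim by (simp add: field_simps)
      finally show ?case .
    qed
  qed
  have "(\<lambda>n. ((1 - 2 * e n) * (p n n - 1) + (e n * ((2 * real n + 1) * return_prob n) - e n)) / (e n * sqrt (real n))\<^sup>2)
      \<longlonglongrightarrow> ((1 - 2 * 0) * (exp (c\<^sup>2) * erfc c - 1) + (2 * c / sqrt pi - 0)) / c\<^sup>2"
    using c by (intro tendsto_intros e_lim e0 Q recursion_limit[OF e_pos c e_lim p0 rec]) auto
  moreover have "((1 - 2 * e n) * (p n n - 1) + (e n * ((2 * real n + 1) * return_prob n) - e n)) / (e n * sqrt (real n))\<^sup>2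
      = (\<Sum>k<n. p n k) / real n" for n
  proof -
    have "(e n)\<^sup>2 * (\<Sum>k<n. p n k) = (1 - 2 * e n) * (p n n - 1) + (e n * ((2 * real n + 1) * return_prob n) - e n)"
      using recursion_sum[OF p0 rec, of n n] unfolding sum_return_prob by (simp add: algebra_simps)
    then show ?thesis
      using e_pos[of n] by (simp add: power_mult_distrib flip: \<open>(e n)\<^sup>2 * _ = _\<close>)
  qed
  ultimately show ?thesis by simp
qed

theorem corollary1:
  fixes \<alpha> :: real and \<Delta> :: "nat \<Rightarrow> real"
    and M :: "nat \<Rightarrow> 'a measure" and S :: "nat \<Rightarrow> nat \<Rightarrow> 'a \<Rightarrow> int \<times> int"
  assumes "\<alpha> > 0"
    and "\<And>n. \<Delta> n \<ge> 0"
    and "\<Delta> \<sim>[sequentially] (\<lambda>n. \<alpha> * real n powr (1 / 2))"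
    and "\<And>n. markov_chain (M n) (step_kernel (\<Delta> n)) (0, 0) (S n)"
  shows "(\<lambda>n. inverse (real n) *
            prob_space.expectation (M n)
              (\<lambda>\<omega>. real_of_int (fst (S n n \<omega>)) * real_of_int (snd (S n n \<omega>))))
         \<longlonglongrightarrow> (LBINT s=0..1. exp (4 / \<alpha>\<^sup>2 * s) * erfc (2 / \<alpha> * sqrt s))"
proof -
  define c where "c = 2 / \<alpha>"
  define e where "e n = 2 - u_par (\<Delta> n)" for n
  define p where "p n k = half_gap_prob (\<Delta> n) k 0" for n k
  have c: "c > 0" and c2: "4 / \<alpha>\<^sup>2 = c\<^sup>2"
    using assms(1) by (simp_all add: c_def power_divide)
  have e: "e n = 2 / (2 + \<Delta> n)" for n
    using assms(2)[of n] by (simp add: e_def u_par_def field_simps)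
  have e_pos: "e n > 0" for n
    using assms(2)[of n] by (simp add: e add_pos_nonneg)
  have "(\<lambda>n. \<Delta> n / (\<alpha> * real n powr (1 / 2))) \<longlonglongrightarrow> 1"
    using assms(1,3) by (intro asymp_equivD_strong)
      (auto intro!: eventually_mono[OF eventually_gt_at_top[of 0]])
  then have "(\<lambda>n. \<alpha> * (\<Delta> n / (\<alpha> * real n powr (1 / 2)))) \<longlonglongrightarrow> \<alpha> * 1"
    by (intro tendsto_intros)
  then have D: "(\<lambda>n. \<Delta> n / sqrt (real n)) \<longlonglongrightarrow> \<alpha>"
    using assms(1) by (simp add: powr_half_sqrt)
  have "(\<lambda>n. 2 / (2 / sqrt (real n) + \<Delta> n / sqrt (real n))) \<longlonglongrightarrow> 2 / (0 + \<alpha>)"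
    by (intro tendsto_divide tendsto_add tendsto_const D) (real_asymp, use assms(1) in simp)
  then have "(\<lambda>n. 2 / (2 / sqrt (real n) + \<Delta> n / sqrt (real n))) \<longlonglongrightarrow> c"
    by (simp add: c_def)
  then have e_lim: "(\<lambda>n. e n * sqrt (real n)) \<longlonglongrightarrow> c"
    by (rule Lim_transform_eventually)
       (use eventually_gt_at_top[of 0] in eventually_elim,
        simp add: e flip: add_divide_distrib)
  have e0: "e \<longlonglongrightarrow> 0"
    by (rule tendsto_0_of_sqrt_scaled[OF e_lim])
  have "(\<lambda>n. (\<Sum>k<n. p n k) / real n) \<longlonglongrightarrow> (exp (c\<^sup>2) * erfc c - 1 + 2 * c / sqrt pi) / c\<^sup>2"
  proof (rule recursion_average_limit[OF e_pos c e_lim])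
    show "p n 0 = 1" for n
      by (simp add: p_def half_gap_prob_def)
    show "(1 - 2 * e n) * p n (Suc m) = (1 - e n)\<^sup>2 * p n m - e n * return_prob (Suc m)" for n m
      unfolding p_def e_def by (rule meeting_prob_recursion[OF assms(2)])
  qed
  from tendsto_mult[OF tendsto_diff[OF tendsto_const e0] this, of 1]
  have "(\<lambda>n. (1 - e n) * ((\<Sum>k<n. p n k) / real n)) \<longlonglongrightarrow>
      (exp (c\<^sup>2) * erfc c - 1 + 2 * c / sqrt pi) / c\<^sup>2"
    by (simp only: diff_zero mult_1_left)
  moreover have "inverse (real n) * prob_space.expectation (M n)
      (\<lambda>\<omega>. real_of_int (fst (S n n \<omega>)) * real_of_int (snd (S n n \<omega>))) =
      (1 - e n) * ((\<Sum>k<n. p n k) / real n)" for n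
  proof -
    have "prob_space.expectation (M n)
        (\<lambda>\<omega>. real_of_int (fst (S n n \<omega>)) * real_of_int (snd (S n n \<omega>))) = (1 - e n) * (\<Sum>k<n. p n k)"
      using markov_chain.expectation_state[OF assms(4)[of n],
          where f = "\<lambda>z. real_of_int (fst z) * real_of_int (snd z)" and n = n]
        expectation_product[OF assms(2), of n n]
      by (simp add: e_def p_def)
    then show ?thesis by (simp add: field_simps)
  qed
  ultimately show ?thesis
    unfolding c2 c_def[symmetric] integral_exp_erfc[OF c] by simp
qed

end
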